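(* Let $P_1,P_2,P_3,P_4\in\mathbb{R}[x_1,x_2,x_3,x_4]$ and consider the polynomial differential system in $\mathbb{R}^4$ $$\frac{dx_i}{dt}=P_i(x_1,x_2,x_3,x_4),\qquad i=1,2,3,4.$$ If this system has the Clifford torus $$\mathbb{T}=\left\{(x_1,x_2,x_3,x_4)\in\mathbb{R}^4:\ x_1^2+x_2^2=\tfrac12,\ x_3^2+x_4^2=\tfrac12\right\}$$ invariant, then $$\begin{aligned} P_1&= A\,(x_1^2+x_2^2-1/2)-2Cx_2,\\ P_2&= B\,(x_1^2+x_2^2-1/2)+2Cx_1,\\ P_3&= D\,(x_3^2+x_4^2-1/2)-2Fx_4,\\ P_4&= E\,(x_3^2+x_4^2-1/2)+2Fx_3, \end{aligned}$$ for some polynomials $A,B,C,D,E,F\in\mathbb{R}[x_1,x_2,x_3,x_4]$ (which may be arbitrary).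
   Context: The polynomial vector field associated to the system is $\mathcal{X}=\sum_{i=1}^4 P_i\,\frac{\partial}{\partial x_i}$. For $f\in\mathbb{R}[x_1,x_2,x_3,x_4]$, the hypersurface $f=0$ is an invariant algebraic hypersurface of the system (or of $\mathcal{X}$) if there is a polynomial $K\in\mathbb{R}[x_1,x_2,x_3,x_4]$ (the cofactor) such that $\mathcal{X}f=Kf$. The Clifford torus $\mathbb{T}$ is said to be invariant by the system (an invariant algebraic surface) if both hypersurfaces $x_1^2+x_2^2-1/2=0$ and $x_3^2+x_4^2-1/2=0$ are invariant algebraic hypersurfaces of $\mathcal{X}$. *)

theory Defs
  imports "HOL-Analysis.Analysis" "HOL-Library.Poly_Mapping"
begin

(* R[x_1,x_2,x_3,x_4]: finitely supported maps from exponent vectors to real coefficients, with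
   the convolution product. The index type 4 consists of 1, 2, 3, 4 (where 4 = 0). *)
type_synonym poly4 = "(4 \<Rightarrow>\<^sub>0 nat) \<Rightarrow>\<^sub>0 real"

definition Const :: "real \<Rightarrow> poly4" where
  "Const c = Poly_Mapping.single 0 c"

definition X :: "4 \<Rightarrow> poly4" where
  "X i = Poly_Mapping.single (Poly_Mapping.single i 1) 1"

(* If x_i does not occur in the monomial m, the coefficient of its summand is 0, so the truncated
   subtraction of exponents is harmless. *)
definition partial_deriv :: "4 \<Rightarrow> poly4 \<Rightarrow> poly4" where
  "partial_deriv i f =
     (\<Sum>m\<in>Poly_Mapping.keys f. Poly_Mapping.single (m - Poly_Mapping.single i 1)
        (real (Poly_Mapping.lookup m i) * Poly_Mapping.lookup f m))"

definition vector_field :: "(4 \<Rightarrow> poly4) \<Rightarrow> poly4 \<Rightarrow> poly4" where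
  "vector_field P f = (\<Sum>i\<in>UNIV. P i * partial_deriv i f)"

definition invariant_hypersurface :: "(4 \<Rightarrow> poly4) \<Rightarrow> poly4 \<Rightarrow> bool" where
  "invariant_hypersurface P f \<longleftrightarrow> (\<exists>K. vector_field P f = K * f)"

definition clifford_torus_invariant :: "(4 \<Rightarrow> poly4) \<Rightarrow> bool" where
  "clifford_torus_invariant P \<longleftrightarrow>
     invariant_hypersurface P ((X 1)^2 + (X 2)^2 - Const (1/2)) \<and>
     invariant_hypersurface P ((X 3)^2 + (X 4)^2 - Const (1/2))"

lemma partial_deriv_superset:
  assumes "finite S" "Poly_Mapping.keys f \<subseteq> S"
  shows "partial_deriv i f =
     (\<Sum>m\<in>S. Poly_Mapping.single (m - Poly_Mapping.single i 1)
        (real (Poly_Mapping.lookup m i) * Poly_Mapping.lookup f m))"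
  unfolding partial_deriv_def
  by (rule sum.mono_neutral_left) (use assms in \<open>auto simp: in_keys_iff\<close>)

lemma partial_deriv_single:
  "partial_deriv i (Poly_Mapping.single m c) =
     Poly_Mapping.single (m - Poly_Mapping.single i 1) (real (Poly_Mapping.lookup m i) * c)"
  by (subst partial_deriv_superset[of "{m}"]) auto

lemma partial_deriv_add: "partial_deriv i (f + g) = partial_deriv i f + partial_deriv i g"
proof -
  define S where "S = Poly_Mapping.keys f \<union> Poly_Mapping.keys g"
  have S: "finite S" "Poly_Mapping.keys f \<subseteq> S" "Poly_Mapping.keys g \<subseteq> S"
    "Poly_Mapping.keys (f + g) \<subseteq> S"
    using keys_add[of f g] by (auto simp: S_def)
  show ?thesis
    by (simp add: partial_deriv_superset[OF S(1,2)] partial_deriv_superset[OF S(1,3)]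
        partial_deriv_superset[OF S(1,4)] lookup_add distrib_left single_add sum.distrib)
qed

lemma partial_deriv_diff: "partial_deriv i (f - g) = partial_deriv i f - partial_deriv i g"
  using partial_deriv_add[of i "f - g" g] by simp

lemma partial_deriv_Const: "partial_deriv i (Const c) = 0"
  by (simp add: Const_def partial_deriv_single)

lemma partial_deriv_X: "partial_deriv i (X j) = (if i = j then 1 else 0)"
  by (auto simp: X_def partial_deriv_single lookup_single when_def)

lemma partial_deriv_X_power2: "partial_deriv i ((X j)^2) = (if i = j then 2 * X j else 0)"
proof -
  have sq: "(X j)^2 = Poly_Mapping.single (Poly_Mapping.single j 2) 1"
    by (simp add: X_def power2_eq_square mult_single numeral_2_eq_2 flip: single_add)
  have "(Poly_Mapping.single j 2 :: 4 \<Rightarrow>\<^sub>0 nat) - Poly_Mapping.single j (Suc 0)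
        = Poly_Mapping.single j (Suc 0)"
    by (simp flip: single_diff)
  moreover have "2 * X j = Poly_Mapping.single (Poly_Mapping.single j 1) 2"
    by (simp add: X_def mult_2 flip: single_add)
  ultimately show ?thesis
    by (auto simp: sq partial_deriv_single lookup_single when_def)
qed

end

theory Submission
  imports Defs
begin

text \<open>Write \<open>g = x\<^sup>2 + y\<^sup>2 - c\<close> with \<open>2 * c = 1\<close>. Invariance of \<open>g = 0\<close> means
  \<open>2 * (x * p + y * q) = K * g\<close>, and \<open>1 = 2 * (x\<^sup>2 + y\<^sup>2) - 2 * g\<close>. Multiplying the latter by \<open>p\<close>
  and by \<open>q\<close> and substituting the former gives the normal form with \<open>C = x * q - y * p\<close>.
  The two factors of the torus are treated independently.\<close>

lemma tangent_to_circle_iff: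
  fixes x y c p q :: "'a :: comm_ring_1"
  assumes c: "2 * c = 1"
  shows "(\<exists>K. p * (2 * x) + q * (2 * y) = K * (x^2 + y^2 - c)) \<longleftrightarrow>
    (\<exists>A B C. p = A * (x^2 + y^2 - c) - 2 * C * y \<and> q = B * (x^2 + y^2 - c) + 2 * C * x)"
proof
  assume "\<exists>K. p * (2 * x) + q * (2 * y) = K * (x^2 + y^2 - c)"
  then obtain K where K: "p * (2 * x) + q * (2 * y) = K * (x^2 + y^2 - c)" ..
  define g where "g = x^2 + y^2 - c"
  have Kg: "p * (2 * x) + q * (2 * y) = K * g"
    using K by (simp add: g_def)
  have one: "2 * (x^2 + y^2) - 2 * g = 1"
    using c by (simp add: g_def algebra_simps)
  \<comment> \<open>The coefficient of \<open>g\<close> comes from 2 * (x^2 + y^2) * p = x * (2*x*p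
    + 2*y*q) - 2 * (x*q - y*p) * y, whose first term is \<open>x * K * g\<close>; the
    \<open>- 2 * p\<close> is the correction from \<open>one\<close>.\<close>
  have "(x * K - 2 * p) * g - 2 * (x * q - y * p) * y
      = x * (K * g) - 2 * p * g - 2 * (x * q - y * p) * y"
    by (simp add: algebra_simps)
  also have "\<dots> = p * (2 * (x^2 + y^2) - 2 * g)"
    unfolding Kg[symmetric] by (simp add: algebra_simps power2_eq_square)
  finally have p: "p = (x * K - 2 * p) * g - 2 * (x * q - y * p) * y"
    unfolding one by simp
  \<comment> \<open>Swapping (x, p) with (y, q) flips the sign of x*q - y*p, so the same
    \<open>C\<close> serves both equations, with opposite signs.\<close>
  have "(y * K - 2 * q) * g + 2 * (x * q - y * p) * x
      = y * (K * g) - 2 * q * g + 2 * (x * q - y * p) * x"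
    by (simp add: algebra_simps)
  also have "\<dots> = q * (2 * (x^2 + y^2) - 2 * g)"
    unfolding Kg[symmetric] by (simp add: algebra_simps power2_eq_square)
  finally have q: "q = (y * K - 2 * q) * g + 2 * (x * q - y * p) * x"
    unfolding one by simp
  from p q show "\<exists>A B C. p = A * (x^2 + y^2 - c) - 2 * C * y \<and> q = B * (x^2 + y^2 - c) + 2 * C * x"
    unfolding g_def by blast
next
  assume "\<exists>A B C. p = A * (x^2 + y^2 - c) - 2 * C * y \<and> q = B * (x^2 + y^2 - c) + 2 * C * x"
  then obtain A B C where pq: "p = A * (x^2 + y^2 - c) - 2 * C * y" "q = B * (x^2 + y^2 - c) + 2 * C * x"
    by blast
  \<comment> \<open>The two terms in \<open>C\<close> cancel: the rotation field (-y, x) is tangent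
    to every circle about the origin.\<close>
  have "p * (2 * x) + q * (2 * y) = (2 * (x * A + y * B)) * (x^2 + y^2 - c)"
    unfolding pq by (simp add: algebra_simps)
  then show "\<exists>K. p * (2 * x) + q * (2 * y) = K * (x^2 + y^2 - c)" ..
qed

text \<open>The only fact about the constant 1/2 that the ring argument needs.\<close>

lemma two_mult_Const_half: "2 * Const (1/2) = 1"
  by (simp add: Const_def mult_2 flip: single_add)

lemma vector_field_circle:
  assumes "i \<noteq> j"
  shows "vector_field P ((X i)^2 + (X j)^2 - Const c) = P i * (2 * X i) + P j * (2 * X j)"
proof -
  \<comment> \<open>With the summand split into two indicator terms, each sum collapses to one
    index.\<close>
  have "vector_field P ((X i)^2 + (X j)^2 - Const c)
      = (\<Sum>k\<in>UNIV. (if k = i then P k * (2 * X i) else 0) + (if k = j then P k * (2 * X j) else 0))"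
    unfolding vector_field_def
    by (intro sum.cong) (auto simp: partial_deriv_add partial_deriv_diff partial_deriv_Const
        partial_deriv_X_power2 distrib_left)
  then show ?thesis
    by (simp add: sum.distrib)
qed

lemma invariant_circle_iff:
  assumes "i \<noteq> j"
  shows "invariant_hypersurface P ((X i)^2 + (X j)^2 - Const (1/2)) \<longleftrightarrow>
    (\<exists>A B C. P i = A * ((X i)^2 + (X j)^2 - Const (1/2)) - 2 * C * X j \<and>
             P j = B * ((X i)^2 + (X j)^2 - Const (1/2)) + 2 * C * X i)"
  unfolding invariant_hypersurface_def vector_field_circle[OF assms]
  by (rule tangent_to_circle_iff[OF two_mult_Const_half])

theorem theorem1:
  fixes P :: "4 \<Rightarrow> poly4"
  shows "clifford_torus_invariant P \<longleftrightarrow>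
    (\<exists>A B C D E F :: poly4.
       P 1 = A * ((X 1)^2 + (X 2)^2 - Const (1/2)) - 2 * C * X 2 \<and>
       P 2 = B * ((X 1)^2 + (X 2)^2 - Const (1/2)) + 2 * C * X 1 \<and>
       P 3 = D * ((X 3)^2 + (X 4)^2 - Const (1/2)) - 2 * F * X 4 \<and>
       P 4 = E * ((X 3)^2 + (X 4)^2 - Const (1/2)) + 2 * F * X 3)"
proof -
  \<comment> \<open>Numerals of type \<open>4\<close> are residues modulo 4, with \<open>4\<close>
    equal to \<open>0\<close>.\<close>
  have ne: "(1::4) \<noteq> 2" "(3::4) \<noteq> 4"
    by simp_all
  show ?thesis
    unfolding clifford_torus_invariant_def invariant_circle_iff[OF ne(1)]
      invariant_circle_iff[OF ne(2)]
    by blast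
qed

end
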